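(* Let $p > 2$ be an even integer, and let $(s,c)$ be the (unique) holomorphic solution pair in the open polygonal band $\mathcal{P}$ of the complex initial value problem $s' = c^{p-1}$, $c' = -s^{p-1}$, $s(0)=0$, $c(0)=1$. Then $(s,c)$ has period $8K_p$: for all $z \in \mathcal{P}$, $s(z+8K_p)=s(z)$ and $c(z+8K_p)=c(z)$.
   Context: Let $K_p := \int_0^1 \frac{d\zeta}{(1+\zeta^p)^{2/p}} > 0$. Let $\mathbb{P} \subset \mathbb{C}$ be the open regular $p$-gon that is centred at $0$ and has the positive real number $K_p$ as the midpoint of one of its edges. For $p$ even, $\mathcal{P}$ is the union of the translates $\mathbb{P} + 2nK_p$ ($n \in \mathbb{Z}$) together with the open segments (open edges, without the vertices) that lie between adjacent translates, i.e. the common open edges centred at the points $(2n+1)K_p$, $n\in\mathbb{Z}$. Thus $\mathcal{P}$ is an open neighbourhood of the real axis. The initial value problem has a unique holomorphic solution pair on $\mathcal{P}$. A holomorphic solution pair on a connected open set $U \ni 0$ is a pair of holomorphic functions $s,c : U \to \mathbb{C}$ satisfying the differential equations on $U$ and the initial conditions at $0$. *)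

theory Defs
  imports "HOL-Complex_Analysis.Complex_Analysis"
begin

definition K_const :: "nat \<Rightarrow> real" where
  "K_const p = integral {0..1} (\<lambda>\<zeta>::real. 1 / (1 + \<zeta> ^ p) powr (2 / real p))"

(* A regular p-gon with apothem K_p has circumradius K_p / cos (pi / p).  Its vertices lie at
   the odd multiples of pi / p, so that the midpoints of the edges lie at the even ones. *)
definition gon_vertex :: "nat \<Rightarrow> int \<Rightarrow> complex" where
  "gon_vertex p k =
     complex_of_real (K_const p / cos (pi / real p)) * cis ((2 * real_of_int k + 1) * pi / real p)"

definition open_gon :: "nat \<Rightarrow> complex set" where
  "open_gon p = interior (convex hull (gon_vertex p ` {0..<int p}))"

definition right_edge :: "nat \<Rightarrow> complex set" where
  "right_edge p = open_segment (gon_vertex p (- 1)) (gon_vertex p 0)"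

lemma midpoint_right_edge:
  assumes "p > 2"
  shows "midpoint (gon_vertex p (- 1)) (gon_vertex p 0) = complex_of_real (K_const p)"
proof -
  have "pi / real p < pi / 2"
    using assms by (intro divide_strict_left_mono) auto
  then have "cos (pi / real p) > 0"
    using assms by (intro cos_gt_zero_pi) (auto intro: less_trans[of _ 0])
  then show ?thesis
    by (simp add: gon_vertex_def midpoint_def complex_eq_iff)
qed

(* For even p the left edge of open_gon p + 2 (n + 1) K_p coincides with the right edge of
   open_gon p + 2 n K_p, the edge centred at (2 n + 1) K_p. *)
definition gon_band :: "nat \<Rightarrow> complex set" where
  "gon_band p =
     (\<Union>n::int. (\<lambda>z. z + complex_of_real (2 * real_of_int n * K_const p)) ` open_gon p) \<union>
     (\<Union>n::int. (\<lambda>z. z + complex_of_real (2 * real_of_int n * K_const p)) ` right_edge p)"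

lemma gon_band_shift:
  assumes "z \<in> gon_band p"
  shows "z + complex_of_real (2 * real_of_int m * K_const p) \<in> gon_band p"
proof -
  have *: "w + complex_of_real (2 * real_of_int n * K_const p)
            + complex_of_real (2 * real_of_int m * K_const p)
          = w + complex_of_real (2 * real_of_int (n + m) * K_const p)" for w n
    by (simp add: algebra_simps)
  show ?thesis
    using assms unfolding gon_band_def by (auto simp only: * Un_iff UN_iff image_iff) blast+
qed

(* Meant for open connected U containing 0. *)
definition holomorphic_solution_pair ::
    "nat \<Rightarrow> complex set \<Rightarrow> (complex \<Rightarrow> complex) \<Rightarrow> (complex \<Rightarrow> complex) \<Rightarrow> bool" where
  "holomorphic_solution_pair p U s c \<longleftrightarrow>
     s holomorphic_on U \<and> c holomorphic_on U \<and>
     (\<forall>z\<in>U. (s has_field_derivative c z ^ (p - 1)) (at z)) \<and>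
     (\<forall>z\<in>U. (c has_field_derivative - (s z ^ (p - 1))) (at z)) \<and>
     s 0 = 0 \<and> c 0 = 1"

end

theory Submission imports Defs begin

text \<open>
  On the real axis the quotient \<open>u = s / c\<close> satisfies \<open>u' = (1 + u\<^sup>p)\<^bsup>2/p\<^esup>\<close>, because
  \<open>s\<^sup>p + c\<^sup>p = 1\<close>.  Hence \<open>u\<close> reaches \<open>1\<close> exactly at \<open>K\<^sub>p\<close>, that is, \<open>s\<close> and \<open>c\<close> agree there.
  As \<open>(c(2K\<^sub>p - t), s(2K\<^sub>p - t))\<close> and, for even \<open>p\<close>, \<open>(-s(-t), c(-t))\<close> solve the same system,
  uniqueness yields \<open>s(t + 2K\<^sub>p) = c(t)\<close> and \<open>c(t + 2K\<^sub>p) = -s(t)\<close>, and thus the period \<open>8K\<^sub>p\<close> on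
  the real axis.  The identity theorem carries it over to each open polygon of the band, and
  continuity to the edges in between.
\<close>

section \<open>The real initial value problem\<close>

text \<open>The value type is left open because the system is used both for the complex restriction
  of the solution pair to the real axis and for its real parts; \<open>n\<close> stands for
  \<open>p - 1\<close>.\<close>

definition trig_system :: "nat \<Rightarrow> (real \<Rightarrow> 'a) \<Rightarrow> (real \<Rightarrow> 'a::real_normed_field) \<Rightarrow> bool" where
  "trig_system n x y \<longleftrightarrow>
     (\<forall>t. (x has_vector_derivative y t ^ n) (at t) \<and>
          (y has_vector_derivative - (x t ^ n)) (at t))"

text \<open>Gronwall estimate: the squared norm \<open>E\<close> of \<open>(x, y)\<close> satisfies
  \<open>E' <= M * E\<close> on \<open>{a..b}\<close>, so \<open>E t * exp (- M * t)\<close> cannot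
  increase from its initial value 0. The inner product makes the same argument serve real and
  complex values.\<close>

lemma linear_system_zero_forward:
  fixes x y h k :: "real \<Rightarrow> 'a::{real_inner,real_normed_algebra}"
  assumes x: "\<And>t. (x has_vector_derivative h t * y t) (at t)"
    and y: "\<And>t. (y has_vector_derivative k t * x t) (at t)"
    and h: "continuous_on UNIV h" and k: "continuous_on UNIV k"
    and init: "x a = 0" "y a = 0" and "a \<le> b"
  shows "x b = 0 \<and> y b = 0"
proof -
  have "continuous_on {a..b} (\<lambda>t. norm (h t) + norm (k t))"
    by (intro continuous_intros continuous_on_subset[OF h] continuous_on_subset[OF k]) auto
  then have "bounded ((\<lambda>t. norm (h t) + norm (k t)) ` {a..b})"
    by (intro compact_imp_bounded compact_continuous_image) auto
  then obtain M where "\<forall>t\<in>{a..b}. norm (h t) + norm (k t) \<le> M"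
    unfolding bounded_iff by auto
  then have M: "norm (h t) + norm (k t) \<le> M" if "t \<in> {a..b}" for t
    using that by blast
  define E where "E t = x t \<bullet> x t + y t \<bullet> y t" for t
  define E' where "E' t = 2 * (x t \<bullet> (h t * y t)) + 2 * (y t \<bullet> (k t * x t))" for t
  have E: "(E has_real_derivative E' t) (at t)" for t
    unfolding E_def[abs_def] E'_def has_real_derivative_iff_has_vector_derivative
    by (rule derivative_eq_intros bounded_bilinear.has_vector_derivative[OF bounded_bilinear_inner] x y)+
       (simp add: inner_commute)
  have E'_le: "E' t \<le> M * E t" if "t \<in> {a..b}" for t
  proof -
    have 1: "x t \<bullet> (h t * y t) \<le> norm (x t) * (norm (h t) * norm (y t))"
      by (rule order_trans[OF norm_cauchy_schwarz]) (intro mult_left_mono norm_mult_ineq norm_ge_zero)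
    have 2: "y t \<bullet> (k t * x t) \<le> norm (y t) * (norm (k t) * norm (x t))"
      by (rule order_trans[OF norm_cauchy_schwarz]) (intro mult_left_mono norm_mult_ineq norm_ge_zero)
    have "E' t \<le> (norm (h t) + norm (k t)) * (2 * norm (x t) * norm (y t))"
      using 1 2 by (simp add: E'_def algebra_simps)
    also have "\<dots> \<le> (norm (h t) + norm (k t)) * E t"
      using sum_squares_bound[of "norm (x t)" "norm (y t)"]
      by (intro mult_left_mono) (auto simp: E_def power2_norm_eq_inner)
    also have "\<dots> \<le> M * E t"
      by (intro mult_right_mono M that) (simp add: E_def)
    finally show ?thesis .
  qed
  have "E b * exp (- M * b) \<le> E a * exp (- M * a)"
  proof (rule DERIV_nonpos_imp_nonincreasing[OF \<open>a \<le> b\<close>])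
    fix t assume t: "a \<le> t" "t \<le> b"
    have "((\<lambda>t. E t * exp (- M * t)) has_real_derivative (E' t - M * E t) * exp (- M * t)) (at t)"
      by (rule derivative_eq_intros E refl)+ (simp add: algebra_simps)
    moreover have "(E' t - M * E t) * exp (- M * t) \<le> 0"
      using E'_le[of t] t by (simp add: mult_nonpos_nonneg)
    ultimately show "\<exists>d. ((\<lambda>t. E t * exp (- M * t)) has_real_derivative d) (at t) \<and> d \<le> 0"
      by blast
  qed
  then have "E b \<le> 0"
    using init by (simp add: E_def mult_le_0_iff not_le[symmetric])
  moreover have "x b \<bullet> x b \<ge> 0" "y b \<bullet> y b \<ge> 0" by simp_all
  ultimately have "x b \<bullet> x b = 0" "y b \<bullet> y b = 0"
    unfolding E_def by linarith+
  then show ?thesis by simp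
qed

lemma has_vector_derivative_reflect:
  assumes "(f has_vector_derivative D) (at (a - t))"
  shows "((\<lambda>t. f (a - t)) has_vector_derivative - D) (at (t::real))"
proof -
  have "((\<lambda>t. a - t) has_vector_derivative -1) (at t)"
    by (auto intro!: derivative_eq_intros)
  from vector_diff_chain_at[OF this assms] show ?thesis
    by (simp add: o_def)
qed

text \<open>Times before \<open>a\<close> are reached by reversing time, which keeps the form of the
  system with coefficients \<open>- h (- t)\<close> and \<open>- k (- t)\<close>.\<close>

lemma linear_system_zero:
  fixes x y h k :: "real \<Rightarrow> 'a::{real_inner,real_normed_algebra}"
  assumes x: "\<And>t. (x has_vector_derivative h t * y t) (at t)"
    and y: "\<And>t. (y has_vector_derivative k t * x t) (at t)"
    and h: "continuous_on UNIV h" and k: "continuous_on UNIV k"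
    and init: "x a = 0" "y a = 0"
  shows "x b = 0 \<and> y b = 0"
proof (cases "a \<le> b")
  case True
  then show ?thesis
    using linear_system_zero_forward[OF x y h k init] by blast
next
  case False
  have reflect: "((\<lambda>t. z (- t)) has_vector_derivative - w t * v t) (at t)"
    if "\<And>t. (z has_vector_derivative w (- t) * v (- t)) (at t)"
    for z v w :: "real \<Rightarrow> 'a" and t
    using has_vector_derivative_reflect[of z "w t * v t" 0 t] that[of "- t"] by simp
  have "x (- (- b)) = 0 \<and> y (- (- b)) = 0"
  proof (rule linear_system_zero_forward[where x = "\<lambda>t. x (- t)" and y = "\<lambda>t. y (- t)" and a = "- a"])
    show "((\<lambda>t. x (- t)) has_vector_derivative - h (- t) * y (- t)) (at t)" for t
      by (rule reflect) (simp add: x)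
    show "((\<lambda>t. y (- t)) has_vector_derivative - k (- t) * x (- t)) (at t)" for t
      by (rule reflect) (simp add: y)
    show "continuous_on UNIV (\<lambda>t. - h (- t))" "continuous_on UNIV (\<lambda>t. - k (- t))"
      by (intro continuous_intros continuous_on_compose2[OF h] continuous_on_compose2[OF k]; simp)+
  qed (use False init in auto)
  then show ?thesis by simp
qed

section \<open>Uniqueness and symmetries of the nonlinear system\<close>

lemma trig_system_continuous:
  assumes "trig_system n x y"
  shows "continuous_on A x" "continuous_on A y"
  using assms unfolding trig_system_def
  by (auto intro!: continuous_at_imp_continuous_on has_vector_derivative_continuous)

text \<open>Since \<open>y^n - v^n\<close> is \<open>y - v\<close> times a polynomial in
  \<open>y\<close> and \<open>v\<close>, the differences of two solutions solve a linear system with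
  continuous coefficients and vanish at \<open>a\<close>.\<close>

lemma trig_system_unique:
  fixes x y u v :: "real \<Rightarrow> 'a::{real_inner,real_normed_field}"
  assumes xy: "trig_system n x y" and uv: "trig_system n u v"
    and eq: "x a = u a" "y a = v a"
  shows "x t = u t \<and> y t = v t"
proof -
  have "x t - u t = 0 \<and> y t - v t = 0"
  proof (rule linear_system_zero)
    have "(\<Sum>i<n. v t ^ (n - Suc i) * y t ^ i) * (y t - v t) = y t ^ n - v t ^ n" for t
      by (simp add: power_diff_sumr2 mult.commute)
    then show "((\<lambda>t. x t - u t) has_vector_derivative
            (\<Sum>i<n. v t ^ (n - Suc i) * y t ^ i) * (y t - v t)) (at t)" for t
      using xy uv by (auto simp: trig_system_def intro!: has_vector_derivative_diff)
    have "- (\<Sum>i<n. u t ^ (n - Suc i) * x t ^ i) * (x t - u t) = - (x t ^ n) - - (u t ^ n)" for t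
      by (simp add: power_diff_sumr2[of "x t" n "u t"] mult.commute flip: minus_diff_eq[of "x t ^ n" "u t ^ n"])
    moreover have "((\<lambda>t. y t - v t) has_vector_derivative - (x t ^ n) - - (u t ^ n)) (at t)" for t
      using xy uv by (intro has_vector_derivative_diff) (auto simp: trig_system_def)
    ultimately show "((\<lambda>t. y t - v t) has_vector_derivative
            - (\<Sum>i<n. u t ^ (n - Suc i) * x t ^ i) * (x t - u t)) (at t)" for t
      by simp
    show "continuous_on UNIV (\<lambda>t. \<Sum>i<n. v t ^ (n - Suc i) * y t ^ i)"
      by (intro continuous_intros trig_system_continuous[OF xy] trig_system_continuous[OF uv])
    show "continuous_on UNIV (\<lambda>t. - (\<Sum>i<n. u t ^ (n - Suc i) * x t ^ i))"
      by (intro continuous_intros trig_system_continuous[OF xy] trig_system_continuous[OF uv])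
  qed (use eq in auto)
  then show ?thesis by simp
qed

text \<open>Time reversal changes the sign of both derivatives; exchanging the two functions
  restores the system.\<close>

lemma trig_system_swap:
  assumes "trig_system n x y"
  shows "trig_system n (\<lambda>t. y (a - t)) (\<lambda>t. x (a - t))"
  using assms has_vector_derivative_reflect[of y "- (x (a - t) ^ n)" a t for t]
    has_vector_derivative_reflect[of x "y (a - t) ^ n" a t for t]
  by (simp add: trig_system_def)

text \<open>The sign passes through the odd power. With uniqueness this makes \<open>x\<close> odd
  and \<open>y\<close> even when \<open>x 0 = 0\<close>.\<close>

lemma trig_system_reflect:
  assumes "trig_system n x y" and "odd n"
  shows "trig_system n (\<lambda>t. - x (- t)) (\<lambda>t. y (- t))"
  using assms has_vector_derivative_reflect[of y "- (x (- t) ^ n)" 0 t for t]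
    has_vector_derivative_minus[OF has_vector_derivative_reflect[of x "y (- t) ^ n" 0 t for t]]
  by (simp add: trig_system_def)

lemma trig_system_cnj:
  assumes "trig_system n x y"
  shows "trig_system n (\<lambda>t. cnj (x t)) (\<lambda>t. cnj (y t))"
  unfolding trig_system_def
proof (intro allI conjI)
  fix t
  show "((\<lambda>t. cnj (x t)) has_vector_derivative cnj (y t) ^ n) (at t)"
    using assms has_vector_derivative_cnj[of x "y t ^ n" t UNIV] by (simp add: trig_system_def)
  show "((\<lambda>t. cnj (y t)) has_vector_derivative - (cnj (x t) ^ n)) (at t)"
    using assms has_vector_derivative_cnj[of y "- (x t ^ n)" t UNIV] by (simp add: trig_system_def)
qed

text \<open>The conjugate pair solves the same system with the same real initial values, so by
  uniqueness both functions are real-valued, and on real values \<open>Re\<close> commutes with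
  powers.\<close>

lemma trig_system_Re:
  assumes xy: "trig_system n x y" and init: "x 0 = 0" "y 0 = 1"
  shows "x t = complex_of_real (Re (x t))" "y t = complex_of_real (Re (y t))"
    and "trig_system n (\<lambda>t. Re (x t)) (\<lambda>t. Re (y t))"
proof -
  have "cnj (x t) = x t \<and> cnj (y t) = y t" for t
    using trig_system_unique[OF trig_system_cnj[OF xy] xy, of 0] init by simp
  then have real: "x t = complex_of_real (Re (x t))" "y t = complex_of_real (Re (y t))" for t
    by (simp_all add: complex_eq_iff)
  then show "x t = complex_of_real (Re (x t))" "y t = complex_of_real (Re (y t))" by auto
  have "Re (x t ^ n) = Re (x t) ^ n" "Re (y t ^ n) = Re (y t) ^ n" for t
    by (subst real, simp flip: of_real_power)+
  then show "trig_system n (\<lambda>t. Re (x t)) (\<lambda>t. Re (y t))"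
    using xy bounded_linear.has_vector_derivative[OF bounded_linear_Re, of x "y t ^ n" "at t" for t]
      bounded_linear.has_vector_derivative[OF bounded_linear_Re, of y "- (x t ^ n)" "at t" for t]
    by (simp add: trig_system_def)
qed

lemma trig_system_period:
  fixes x y :: "real \<Rightarrow> 'a::{real_inner,real_normed_field}"
  assumes xy: "trig_system n x y" and "odd n" and "x 0 = 0" and meet: "x K = y K"
  shows "x (t + 8 * K) = x t" "y (t + 8 * K) = y t"
proof -
  have odd: "x (- t) = - x t" "y (- t) = y t" for t
    using trig_system_unique[OF xy trig_system_reflect[OF xy \<open>odd n\<close>], of 0 "- t"] \<open>x 0 = 0\<close>
    by simp_all
  \<comment> \<open>Uniqueness is anchored at \<open>K\<close>, the fixed point of the reflection
    about \<open>K\<close>: the swapped pair has the same values there precisely because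
    \<open>x K = y K\<close>.\<close>
  have swap: "x (t + 2 * K) = y (- t) \<and> y (t + 2 * K) = x (- t)" for t
  proof -
    have "2 * K - K = K" "2 * K - (t + 2 * K) = - t" by simp_all
    then show ?thesis
      using trig_system_unique[OF xy trig_system_swap[OF xy, of "2 * K"], of K "t + 2 * K"] meet
      by argo
  qed
  then have quarter: "x (t + 2 * K) = y t" "y (t + 2 * K) = - x t" for t
    unfolding odd by simp_all
  \<comment> \<open>A shift by \<open>2 * K\<close> acts as the quarter turn from
    \<open>(x, y)\<close> to \<open>(y, -x)\<close>, which has order four.\<close>
  have eight: "t + 8 * K = t + 2 * K + 2 * K + 2 * K + 2 * K" by simp
  show "x (t + 8 * K) = x t" "y (t + 8 * K) = y t"
    unfolding eight quarter by simp_all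
qed

section \<open>The quarter period\<close>

text \<open>Isolated from \<open>K_const\<close> so that the integral can be taken up to any
  quotient \<open>x T / y T\<close> instead of 1.\<close>

definition K_integrand :: "nat \<Rightarrow> real \<Rightarrow> real" where
  "K_integrand p z = 1 / (1 + z ^ p) powr (2 / real p)"

lemma one_plus_even_power_pos: "even p \<Longrightarrow> 1 + (z::real) ^ p > 0"
  by (simp add: add_pos_nonneg zero_le_even_power)

lemma K_integrand_pos: "even p \<Longrightarrow> K_integrand p z > 0"
  using one_plus_even_power_pos[of p z] by (simp add: K_integrand_def)

lemma K_integrand_continuous: "even p \<Longrightarrow> continuous_on A (K_integrand p)"
  unfolding K_integrand_def[abs_def]
  by (intro continuous_intros) (metis one_plus_even_power_pos less_irrefl powr_eq_0_iff)+

text \<open>The integral up to a quotient will turn out to be the elapsed time, so this translates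
  comparisons of times into comparisons of quotients.\<close>

lemma integral_K_integrand_strict_mono:
  assumes "even p" "0 \<le> a" "a < b"
  shows "integral {0..a} (K_integrand p) < integral {0..b} (K_integrand p)"
proof -
  have int: "K_integrand p integrable_on {c..d}" for c d
    by (intro integrable_continuous_interval K_integrand_continuous assms)
  have "integral {a..b} (\<lambda>_. 0) < integral {a..b} (K_integrand p)"
    using assms by (intro integral_less_real K_integrand_continuous K_integrand_pos) auto
  moreover have "integral {0..a} (K_integrand p) + integral {a..b} (K_integrand p)
      = integral {0..b} (K_integrand p)"
    using assms by (intro Henstock_Kurzweil_Integration.integral_combine int) auto
  ultimately show ?thesis by simp
qed

lemma K_const_eq: "K_const p = integral {0..1} (K_integrand p)"
  by (simp add: K_const_def K_integrand_def[abs_def])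

lemma K_const_pos: "even p \<Longrightarrow> K_const p > 0"
  using integral_K_integrand_strict_mono[of p 0 1] by (simp add: K_const_eq)

section \<open>The real solution between 0 and \<open>K_const p\<close>\<close>

context
  fixes p :: nat and x y :: "real \<Rightarrow> real"
  assumes p: "p > 0" "even p" and xy: "trig_system (p - 1) x y"
    and init: "x 0 = 0" "y 0 = 1"
begin

lemma trig_system_DERIV:
  "(x has_real_derivative y t ^ (p - 1)) (at t)"
  "(y has_real_derivative - (x t ^ (p - 1))) (at t)"
  using xy by (auto simp: trig_system_def has_real_derivative_iff_has_vector_derivative)

text \<open>The analogue of the Pythagorean identity: both terms of the derivative equal
  \<open>p * x^(p-1) * y^(p-1)\<close> up to opposite signs.\<close>

lemma trig_system_first_integral: "x t ^ p + y t ^ p = 1"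
proof -
  have "((\<lambda>t. x t ^ p + y t ^ p) has_real_derivative 0) (at t)" for t
    by (rule derivative_eq_intros trig_system_DERIV refl)+ simp
  then have "x t ^ p + y t ^ p = x 0 ^ p + y 0 ^ p"
    using DERIV_isconst_all[of "\<lambda>t. x t ^ p + y t ^ p" t 0] by auto
  then show ?thesis using p init by simp
qed

text \<open>Positivity is assumed only before \<open>T\<close>, so that the lemma also applies when
  \<open>T\<close> is the first zero of \<open>y\<close>.\<close>

lemma sine_nonneg:
  assumes "0 \<le> T" and pos: "\<And>t. 0 \<le> t \<Longrightarrow> t < T \<Longrightarrow> y t > 0"
  shows "x T \<ge> 0"
proof -
  have "x 0 \<le> x T"
  proof (rule DERIV_nonneg_imp_increasing_open[OF \<open>0 \<le> T\<close>])
    show "\<exists>d. (x has_real_derivative d) (at t) \<and> d \<ge> 0" if "0 < t" "t < T" for t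
      using trig_system_DERIV(1)[of t] pos[of t] that by (intro exI[of _ "y t ^ (p - 1)"]) auto
    show "continuous_on {0..T} x"
      by (rule trig_system_continuous[OF xy])
  qed
  with init show ?thesis by simp
qed

text \<open>Substitute \<open>u = x / y\<close>. The first integral gives
  \<open>u' = 1 / y^2\<close> and \<open>1 + u^p = 1 / y^p\<close>, so the integrand at
  \<open>u\<close> is \<open>y^2\<close>; the transformed integrand is 1 and its integral over
  \<open>{0..T}\<close> is \<open>T\<close>.\<close>

lemma integral_to_quotient:
  assumes "0 \<le> T" and pos: "\<And>t. 0 \<le> t \<Longrightarrow> t \<le> T \<Longrightarrow> y t > 0"
  shows "integral {0..x T / y T} (K_integrand p) = T"
proof -
  define u where "u t = x t / y t" for t
  have u: "(u has_real_derivative 1 / y t ^ 2) (at t)" if "t \<in> {0..T}" for t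
  proof -
    have "y t > 0" using pos that by simp
    then have "(u has_real_derivative (y t ^ (p - 1) * y t - x t * - (x t ^ (p - 1))) / (y t * y t)) (at t)"
      unfolding u_def[abs_def] by (intro DERIV_divide trig_system_DERIV) simp
    moreover have "y t ^ (p - 1) * y t - x t * - (x t ^ (p - 1)) = 1"
      using trig_system_first_integral[of t] power_minus_mult[OF p(1), of "x t"]
        power_minus_mult[OF p(1), of "y t"] by (simp add: mult.commute)
    ultimately show ?thesis by (simp add: power2_eq_square)
  qed
  have integrand: "1 / y t ^ 2 * K_integrand p (u t) = 1" if "t \<in> {0..T}" for t
  proof -
    have y: "y t > 0" using pos that by simp
    have "1 + u t ^ p = 1 / y t ^ p"
      using y trig_system_first_integral[of t] by (simp add: u_def field_simps)
    also have "\<dots> = y t powr (- real p)"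
      using y by (simp add: powr_minus powr_realpow divide_inverse)
    finally have "(1 + u t ^ p) powr (2 / real p) = y t powr (- 2)"
      using p by (simp add: powr_powr)
    also have "\<dots> = 1 / y t ^ 2"
      using y by (simp add: powr_minus divide_inverse)
    finally show ?thesis using y by (simp add: K_integrand_def)
  qed
  have mono: "u s \<le> u t" if "0 \<le> s" "s \<le> t" "t \<le> T" for s t
  proof (rule DERIV_nonneg_imp_nondecreasing[OF \<open>s \<le> t\<close>])
    show "\<exists>d. (u has_real_derivative d) (at r) \<and> d \<ge> 0" if "s \<le> r" "r \<le> t" for r
      using u[of r] that \<open>0 \<le> s\<close> \<open>t \<le> T\<close> by (intro exI[of _ "1 / y r ^ 2"]) auto
  qed
  have "((\<lambda>t. (1 / y t ^ 2) *\<^sub>R K_integrand p (u t)) has_integral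
          integral {u 0..u T} (K_integrand p)) {0..T}"
  proof (rule has_integral_substitution[OF \<open>0 \<le> T\<close>, where c = "u 0" and d = "u T"])
    show "u ` {0..T} \<subseteq> {u 0..u T}" using mono by auto
    show "(u has_real_derivative 1 / (y t)\<^sup>2) (at t within {0..T})" if "t \<in> {0..T}" for t
      using u[OF that] by (rule has_field_derivative_at_within)
  qed (use mono \<open>0 \<le> T\<close> p in \<open>auto intro: K_integrand_continuous\<close>)
  moreover have "((\<lambda>t. (1 / y t ^ 2) *\<^sub>R K_integrand p (u t)) has_integral T) {0..T}"
    using has_integral_const_real[of "1::real" 0 T] \<open>0 \<le> T\<close>
    by (subst has_integral_cong[where g = "\<lambda>_. 1"]) (simp_all only: real_scaleR_def integrand, simp)
  ultimately have "integral {u 0..u T} (K_integrand p) = T"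
    by (rule has_integral_unique)
  then show ?thesis
    using init by (simp add: u_def)
qed

text \<open>Let \<open>T\<close> be the first time with \<open>y T <= 0\<close>. Before
  \<open>T\<close> the quotient stays at most 1, so \<open>x <= y\<close> survives in the limit and
  \<open>0 <= x T <= y T <= 0\<close>. Then both vanish, against the first integral.\<close>

lemma cosine_pos_upto_K:
  assumes "0 \<le> t" "t \<le> K_const p"
  shows "y t > 0"
proof (rule ccontr)
  assume "\<not> y t > 0"
  define A where "A = {0..K_const p} \<inter> {t. y t \<le> 0}"
  have "closed {t. y t \<le> 0}"
    by (intro closed_Collect_le continuous_intros trig_system_continuous[OF xy])
  then have "compact A"
    unfolding A_def by (intro compact_Int_closed) auto
  moreover have "A \<noteq> {}"
    using assms \<open>\<not> y t > 0\<close> by (auto simp: A_def)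
  ultimately obtain T where "T \<in> A" and least: "\<And>s. s \<in> A \<Longrightarrow> T \<le> s"
    using compact_attains_inf[of A] by metis
  then have T: "0 \<le> T" "T \<le> K_const p" "y T \<le> 0" by (auto simp: A_def)
  have pos: "y s > 0" if "0 \<le> s" "s < T" for s
    using least[of s] that T by (force simp: A_def)
  have "T \<noteq> 0" using T init by auto
  \<comment> \<open>A quotient above 1 at time \<open>s\<close> would force
    \<open>s > K_const p\<close>, since the integral up to the quotient is \<open>s\<close>.\<close>
  have less: "x s \<le> y s" if "0 < s" "s < T" for s
  proof (rule ccontr)
    assume "\<not> x s \<le> y s"
    moreover have "y s > 0" using pos that by simp
    ultimately have "x s / y s > 1" by simp
    then have "K_const p < integral {0..x s / y s} (K_integrand p)"
      unfolding K_const_eq using p by (intro integral_K_integrand_strict_mono) auto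
    also have "\<dots> = s"
      using that by (intro integral_to_quotient pos) auto
    finally show False using that T by simp
  qed
  have "x T \<ge> 0"
    using T pos by (intro sine_nonneg)
  have tends: "(f \<longlongrightarrow> f T) (at_left T)" if "continuous_on UNIV f" for f :: "real \<Rightarrow> real"
    using that by (auto simp: continuous_on_def intro: tendsto_mono[OF at_le])
  have "\<forall>\<^sub>F s in at_left T. s \<in> {0<..<T}"
    using T \<open>T \<noteq> 0\<close> by (intro eventually_at_left_real) auto
  then have "\<forall>\<^sub>F s in at_left T. x s \<le> y s"
    by eventually_elim (use less in auto)
  then have "x T \<le> y T"
    by (intro tendsto_le[OF trivial_limit_at_left_real tends tends]
        trig_system_continuous[OF xy])
  with \<open>x T \<ge> 0\<close> T have "x T = 0" "y T = 0" by auto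
  then show False
    using trig_system_first_integral[of T] p by (simp add: power_0_left)
qed

lemma sine_eq_cosine_at_K: "x (K_const p) = y (K_const p)"
proof -
  define K where "K = K_const p"
  have K: "K > 0" using K_const_pos p by (simp add: K_def)
  have pos: "y t > 0" if "0 \<le> t" "t \<le> K" for t
    using cosine_pos_upto_K that by (simp add: K_def)
  have "integral {0..x K / y K} (K_integrand p) = integral {0..1} (K_integrand p)"
    using integral_to_quotient[of K] K pos by (simp add: K_def K_const_eq)
  \<comment> \<open>Strict monotonicity covers only nonnegative upper limits, so the sign must be
    known before the two integrals can be compared.\<close>
  moreover have "x K / y K \<ge> 0"
    using sine_nonneg[of K] pos[of K] pos K by (intro divide_nonneg_pos) auto
  ultimately have "x K / y K = 1"
    using integral_K_integrand_strict_mono[OF p(2), of "x K / y K" 1]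
      integral_K_integrand_strict_mono[OF p(2), of 1 "x K / y K"] by force
  then show ?thesis
    by (simp add: K_def)
qed

end

section \<open>The polygonal band\<close>

lemma Re_Im_gon_vertex:
  "Re (gon_vertex p k) = K_const p / cos (pi / p) * cos ((2 * real_of_int k + 1) * pi / p)"
  "Im (gon_vertex p k) = K_const p / cos (pi / p) * sin ((2 * real_of_int k + 1) * pi / p)"
  by (simp_all add: gon_vertex_def)

lemma cos_pi_div_pos: "p > 2 \<Longrightarrow> cos (pi / real p) > 0"
proof -
  assume "p > 2"
  then have "pi / real p < pi / 2"
    by (intro divide_strict_left_mono) auto
  then show ?thesis
    using \<open>p > 2\<close> by (intro cos_gt_zero_pi) (auto intro: less_trans[of _ 0])
qed

text \<open>The factor \<open>cos (pi / p)\<close> cancels, which shows the right edge as vertical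
  with half length \<open>K_const p * tan (pi / p)\<close>.\<close>

lemma gon_vertex_0: "p > 2 \<Longrightarrow> gon_vertex p 0 = Complex (K_const p) (K_const p * tan (pi / p))"
  using cos_pi_div_pos[of p] by (simp add: complex_eq_iff Re_Im_gon_vertex tan_def)

lemma gon_vertex_minus_1:
  "p > 2 \<Longrightarrow> gon_vertex p (-1) = Complex (K_const p) (- (K_const p * tan (pi / p)))"
  using cos_pi_div_pos[of p] by (simp add: complex_eq_iff Re_Im_gon_vertex tan_def)

text \<open>For even \<open>p\<close>, advancing the index by \<open>p div 2\<close> adds
  \<open>pi\<close> to the angle; this gives the left edge as the negative of the right one.\<close>

lemma gon_vertex_opposite:
  assumes "p > 0" "even p"
  shows "gon_vertex p (k + int (p div 2)) = - gon_vertex p k"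
proof -
  have "(2 * real_of_int (k + int (p div 2)) + 1) * pi / p = (2 * real_of_int k + 1) * pi / p + pi"
    using assms by (auto elim!: evenE simp: field_simps)
  then show ?thesis
    by (simp add: complex_eq_iff Re_Im_gon_vertex)
qed

lemma gon_vertex_periodic:
  assumes "p > 0"
  shows "gon_vertex p (k + int p) = gon_vertex p k"
proof -
  have "(2 * real_of_int (k + int p) + 1) * pi / p = (2 * real_of_int k + 1) * pi / p + 2 * pi"
    using assms by (simp add: field_simps)
  then show ?thesis
    by (simp add: complex_eq_iff Re_Im_gon_vertex)
qed

context
  fixes p :: nat
  assumes p: "p > 2" "even p"
begin

lemma K_tan_pos: "K_const p * tan (pi / p) > 0"
proof -
  have "sin (pi / p) > 0"
    using p by (intro sin_gt_zero) (auto simp: field_simps)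
  then show ?thesis
    using K_const_pos[OF p(2)] cos_pi_div_pos[OF p(1)] by (simp add: tan_def)
qed

text \<open>The rectangle is spanned by the right and left edges, so its corners are vertices and
  convexity does the rest. It yields both the real interval inside the polygon and the right edge in
  its closure.\<close>

lemma rectangle_subset_open_gon:
  "box (Complex (- K_const p) (- (K_const p * tan (pi / p))))
       (Complex (K_const p) (K_const p * tan (pi / p))) \<subseteq> open_gon p"
proof -
  define a where "a = K_const p"
  define b where "b = K_const p * tan (pi / p)"
  define H where "H = convex hull (gon_vertex p ` {0..<int p})"
  have ab: "a > 0" "b > 0"
    using K_const_pos K_tan_pos p by (auto simp: a_def b_def)
  have vertex: "gon_vertex p k \<in> H" if "k \<in> {0..<int p}" for k
    unfolding H_def using that by (intro hull_inc) auto
  \<comment> \<open>The hull is indexed by \<open>{0..<int p}\<close>, so the lower end of the right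
    edge appears there under the index \<open>p - 1\<close>.\<close>
  have "gon_vertex p (- 1) = gon_vertex p (int p - 1)"
    using gon_vertex_periodic[of p "-1"] p by simp
  then have corners: "Complex a b \<in> H" "Complex a (- b) \<in> H"
    using vertex[of 0] vertex[of "int p - 1"] p
      gon_vertex_0[of p] gon_vertex_minus_1[of p] by (auto simp: a_def b_def)
  have "- gon_vertex p 0 = gon_vertex p (int (p div 2))"
    "- gon_vertex p (- 1) = gon_vertex p (int (p div 2) - 1)"
    using gon_vertex_opposite[of p 0] gon_vertex_opposite[of p "-1"] p by simp_all
  then have corners': "Complex (- a) (- b) \<in> H" "Complex (- a) b \<in> H"
    using vertex[of "int (p div 2)"] vertex[of "int (p div 2) - 1"] p
      gon_vertex_0[of p] gon_vertex_minus_1[of p] by (auto simp: a_def b_def Complex_eq)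
  have H: "convex H" by (simp add: H_def)
  have "box (Complex (- a) (- b)) (Complex a b) \<subseteq> H"
  proof
    fix z assume "z \<in> box (Complex (- a) (- b)) (Complex a b)"
    then have z: "- a < Re z" "Re z < a" "- b < Im z" "Im z < b"
      by (auto simp: in_box_complex_iff)
    \<comment> \<open>Interpolation weights: \<open>l\<close> reaches height \<open>Im z\<close> on
      each vertical side, then \<open>m\<close> reaches \<open>z\<close> on the horizontal chord
      between them.\<close>
    define l m where "l = (b + Im z) / (2 * b)" and "m = (a + Re z) / (2 * a)"
    have lm: "0 \<le> l" "l \<le> 1" "0 \<le> m" "m \<le> 1"
      using ab z by (auto simp: l_def m_def field_simps)
    have vert: "Complex r (Im z) \<in> H" if "Complex r b \<in> H" "Complex r (- b) \<in> H" for r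
    proof -
      have "(1 - l) *\<^sub>R Complex r (- b) + l *\<^sub>R Complex r b \<in> H"
        using lm by (intro convexD_alt[OF H] that)
      also have "(1 - l) *\<^sub>R Complex r (- b) + l *\<^sub>R Complex r b = Complex r (Im z)"
        using ab by (simp add: complex_eq_iff l_def field_simps)
      finally show ?thesis .
    qed
    have "(1 - m) *\<^sub>R Complex (- a) (Im z) + m *\<^sub>R Complex a (Im z) \<in> H"
      using lm by (intro convexD_alt[OF H] vert corners corners')
    also have "(1 - m) *\<^sub>R Complex (- a) (Im z) + m *\<^sub>R Complex a (Im z) = z"
      using ab by (simp add: complex_eq_iff m_def field_simps)
    finally show "z \<in> H" .
  qed
  then show ?thesis
    unfolding open_gon_def H_def[symmetric] a_def b_def by (intro interior_maximal) auto
qed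

lemma right_edge_subset_closure: "right_edge p \<subseteq> closure (open_gon p)"
proof -
  let ?b = "K_const p * tan (pi / p)"
  let ?R = "box (Complex (- K_const p) (- ?b)) (Complex (K_const p) ?b)"
  have "0 \<in> ?R"
    using K_const_pos K_tan_pos p by (simp add: in_box_complex_iff)
  then have cl: "closure ?R = cbox (Complex (- K_const p) (- ?b)) (Complex (K_const p) ?b)"
    by (intro closure_box) auto
  have "right_edge p \<subseteq> closed_segment (gon_vertex p (- 1)) (gon_vertex p 0)"
    by (simp add: right_edge_def segment_open_subset_closed)
  also have "\<dots> \<subseteq> closure ?R"
    unfolding cl using p K_const_pos K_tan_pos
    by (intro closed_segment_subset)
       (auto simp: gon_vertex_0 gon_vertex_minus_1 in_cbox_complex_iff intro: less_imp_le)
  also have "\<dots> \<subseteq> closure (open_gon p)"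
    by (intro closure_mono rectangle_subset_open_gon)
  finally show ?thesis .
qed

lemma real_in_open_gon: "\<bar>t\<bar> < K_const p \<Longrightarrow> complex_of_real t \<in> open_gon p"
  using rectangle_subset_open_gon K_tan_pos by (force simp: in_box_complex_iff)

lemma K_in_right_edge: "complex_of_real (K_const p) \<in> right_edge p"
  unfolding right_edge_def midpoint_right_edge[OF p(1), symmetric]
  using K_tan_pos p by (auto simp: midpoint_in_open_segment gon_vertex_0 gon_vertex_minus_1)

lemma real_in_gon_band: "complex_of_real t \<in> gon_band p"
proof -
  let ?K = "K_const p"
  have K: "?K > 0" using K_const_pos p by simp
  \<comment> \<open>The ceiling puts \<open>r\<close> into the interval open at \<open>-K\<close>
    and closed at \<open>K\<close>; the end \<open>K\<close> lies on the right edge of the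
    translate.\<close>
  define n where "n = \<lceil>(t - ?K) / (2 * ?K)\<rceil>"
  define r where "r = t - 2 * real_of_int n * ?K"
  have "real_of_int n - 1 < (t - ?K) / (2 * ?K)" "(t - ?K) / (2 * ?K) \<le> real_of_int n"
    unfolding n_def by linarith+
  then have "- ?K < r" "r \<le> ?K"
    using K by (auto simp: r_def field_simps)
  then have "complex_of_real r \<in> open_gon p \<union> right_edge p"
    using real_in_open_gon[of r] K_in_right_edge by (cases "r = ?K") auto
  moreover have "complex_of_real t = complex_of_real r + complex_of_real (2 * real_of_int n * ?K)"
    by (simp add: r_def)
  ultimately show ?thesis
    unfolding gon_band_def by blast
qed

text \<open>
  Neither openness nor connectedness of the band is needed: the identity theorem is applied in each
  polygon separately, all of which meet the real axis.
\<close>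

lemma gon_band_identity:
  assumes f: "\<And>z. z \<in> gon_band p \<Longrightarrow> f field_differentiable at z"
    and real: "\<And>t. f (complex_of_real t) = 0" and "z \<in> gon_band p"
  shows "f z = 0"
proof -
  have gon: "f (w + complex_of_real (2 * real_of_int n * K_const p)) = 0"
    if w: "w \<in> open_gon p" for w n
  proof -
    let ?g = "\<lambda>w. f (w + complex_of_real (2 * real_of_int n * K_const p))"
    have "?g field_differentiable at w" if "w \<in> open_gon p" for w
    proof -
      have "w + complex_of_real (2 * real_of_int n * K_const p) \<in> gon_band p"
        using that unfolding gon_band_def by blast
      then have "(f \<circ> (\<lambda>w. w + complex_of_real (2 * real_of_int n * K_const p))) field_differentiable at w"
        by (intro field_differentiable_compose f field_differentiable_add
            field_differentiable_ident field_differentiable_const)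
      then show ?thesis by (simp add: o_def)
    qed
    then have hol: "?g holomorphic_on open_gon p"
      by (simp add: holomorphic_on_def field_differentiable_at_within)
    have K: "K_const p > 0" using K_const_pos p by simp
    show ?thesis
    proof (rule analytic_continuation[OF hol])
      show "open (open_gon p)" by (simp add: open_gon_def)
      show "connected (open_gon p)"
        by (simp add: open_gon_def convex_connected convex_interior)
      show "complex_of_real ` {- K_const p<..<K_const p} \<subseteq> open_gon p"
        by (auto intro!: real_in_open_gon)
      show "0 \<in> open_gon p" using real_in_open_gon[of 0] K by simp
      have "0 islimpt {- K_const p<..<K_const p}"
        using K by (intro open_imp_islimpt) auto
      then have "complex_of_real 0 islimpt complex_of_real ` {- K_const p<..<K_const p}"
        by (intro islimpt_isCont_image continuous_intros) (auto simp: eventually_at_filter)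
      then show "0 islimpt complex_of_real ` {- K_const p<..<K_const p}" by simp
      show "?g v = 0" if "v \<in> complex_of_real ` {- K_const p<..<K_const p}" for v
        using that by (elim imageE) (simp only: real flip: of_real_add)
    qed (use w in auto)
  qed
  from \<open>z \<in> gon_band p\<close> obtain w n where
    z: "z = w + complex_of_real (2 * real_of_int n * K_const p)"
    and w: "w \<in> open_gon p \<or> w \<in> right_edge p"
    unfolding gon_band_def by blast
  \<comment> \<open>Edge points are limits of points of the polygon, where \<open>f\<close> is
    already known to vanish after translation, so continuity at \<open>z\<close> settles both cases
    at once.\<close>
  then have "w \<in> closure (open_gon p)"
    using right_edge_subset_closure closure_subset by blast
  then obtain W where W: "\<And>i. W i \<in> open_gon p" "W \<longlonglongrightarrow> w"
    unfolding closure_sequential by blast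
  have "isCont f z"
    using f[OF \<open>z \<in> gon_band p\<close>] by (rule field_differentiable_imp_continuous_at)
  moreover have "(\<lambda>i. W i + complex_of_real (2 * real_of_int n * K_const p)) \<longlonglongrightarrow> z"
    unfolding z by (intro tendsto_intros W)
  ultimately have "(\<lambda>i. f (W i + complex_of_real (2 * real_of_int n * K_const p))) \<longlonglongrightarrow> f z"
    by (rule isCont_tendsto_compose)
  then show ?thesis
    by (simp only: gon[OF W(1)] LIMSEQ_const_iff)
qed

text \<open>The difference of \<open>f\<close> and its translate is differentiable at every band
  point, because the shift preserves the band, and it vanishes on the real axis.\<close>

lemma gon_band_periodic:
  assumes f: "\<And>z. z \<in> gon_band p \<Longrightarrow> f field_differentiable at z"
    and real: "\<And>t. f (complex_of_real (t + 2 * real_of_int m * K_const p)) = f (complex_of_real t)"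
    and z: "z \<in> gon_band p"
  shows "f (z + complex_of_real (2 * real_of_int m * K_const p)) = f z"
proof -
  have "f (z + complex_of_real (2 * real_of_int m * K_const p)) - f z = 0"
  proof (rule gon_band_identity[OF _ _ z])
    fix w assume w: "w \<in> gon_band p"
    have "(f \<circ> (\<lambda>w. w + complex_of_real (2 * real_of_int m * K_const p))) field_differentiable at w"
      by (intro field_differentiable_compose f gon_band_shift w field_differentiable_add
          field_differentiable_ident field_differentiable_const)
    then show "(\<lambda>w. f (w + complex_of_real (2 * real_of_int m * K_const p)) - f w) field_differentiable at w"
      by (intro field_differentiable_diff f w) (simp add: o_def)
  qed (use real in \<open>simp only: diff_self flip: of_real_add\<close>)
  then show ?thesis by simp
qed

end

section \<open>From the real axis to the band\<close>

theorem theorem22: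
  fixes p :: nat and s c :: "complex \<Rightarrow> complex"
  assumes "p > 2" and "even p"
    and "holomorphic_solution_pair p (gon_band p) s c"
  shows "\<forall>z\<in>gon_band p.
           s (z + complex_of_real (8 * K_const p)) = s z \<and>
           c (z + complex_of_real (8 * K_const p)) = c z"
proof -
  have s': "(s has_field_derivative c z ^ (p - 1)) (at z)"
    and c': "(c has_field_derivative - (s z ^ (p - 1))) (at z)" if "z \<in> gon_band p" for z
    using assms(3) that by (auto simp: holomorphic_solution_pair_def)
  define x y where "x t = s (complex_of_real t)" and "y t = c (complex_of_real t)" for t
  have xy: "trig_system (p - 1) x y"
    unfolding trig_system_def x_def[abs_def] y_def[abs_def]
    by (intro allI conjI has_vector_derivative_real_field s' c' real_in_gon_band assms)
  have init: "x 0 = 0" "y 0 = 1"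
    using assms(3) by (simp_all add: x_def y_def holomorphic_solution_pair_def)
  \<comment> \<open>The meeting point was found for real functions; as \<open>x\<close> and
    \<open>y\<close> take real values, equality of the real parts is equality.\<close>
  have "Re (x (K_const p)) = Re (y (K_const p))"
    using sine_eq_cosine_at_K[OF _ \<open>even p\<close> trig_system_Re(3)[OF xy init]] init assms(1) by simp
  then have meet: "x (K_const p) = y (K_const p)"
    using trig_system_Re(1,2)[OF xy init, of "K_const p"] by metis
  have "odd (p - 1)" using assms by simp
  note period = trig_system_period[OF xy this init(1) meet]
  \<comment> \<open>The band is invariant under multiples of \<open>2 * K_const p\<close>, and the
    period is the multiple with \<open>m = 4\<close>.\<close>
  have "2 * real_of_int 4 = 8" by simp
  note gon_band_periodic[OF assms(1,2), where m = 4, unfolded this]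
  moreover have "s field_differentiable at z" "c field_differentiable at z" if "z \<in> gon_band p" for z
    using s'[OF that] c'[OF that] by (auto simp only: field_differentiable_def)
  ultimately show ?thesis
    using period unfolding x_def y_def by blast
qed

end
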